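(* For every set $X$, $\mathscr{M}(X)$ ordered by $\subseteq$, with sequential composition $\cdot$, parallel composition $\|$, units $1_\sigma$ and $1_\pi$, lattice operations $\cup,\cap$ and constants $\emptyset$, $U$, $\overline{1}_\pi$, is a boolean c-quantale.
   Context: For a set $X$, a multirelation over $X$ is a subset of $X\times 2^X$; $\mathscr{M}(X)$ is the set of all of them. $R\cdot S=\{(a,A)\mid \exists B.\ (a,B)\in R\wedge \exists f.\ (\forall b\in B.\ (b,f(b))\in S)\wedge A=\bigcup_{b\in B} f(b)\}$; $R\|S=\{(a,A\cup B)\mid (a,A)\in R\wedge (a,B)\in S\}$; $1_\sigma=\{(x,\{x\})\mid x\in X\}$, $1_\pi=\{(x,\emptyset)\mid x\in X\}$, $U=X\times 2^X$, $\overline{1}_\pi=U\setminus 1_\pi$. A proto-quantale is $(Q,\le,\cdot)$ with $(Q,\le)$ a complete lattice, $x\le y\Rightarrow z\cdot x\le z\cdot y$, and $(\sum_{i\in I}x_i)\cdot y=\sum_{i\in I}(x_i\cdot y)$; it is unital with unit $1$ if $1\cdot x=x=x\cdot 1$. A (commutative) quantale additionally has associative (commutative) multiplication and $x\cdot\sum_i y_i=\sum_i x\cdot y_i$. A proto-bi-quantale is $(Q,\le,\cdot,\|,1_\sigma,1_\pi)$ with $(Q,\le,\cdot,1_\sigma)$ a unital proto-quantale and $(Q,\le,\|,1_\pi)$ a unital commutative quantale. A c-quantale is a proto-bi-quantale which, with $+$ the binary supremum, $\sqcap$ the binary infimum, $0$ the least and $U$ the greatest element and a distinguished element $\overline{1}_\pi$,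 is a c-lattice: $(Q,+,\sqcap,0,U)$ is distributive and for all $x,y,z$: (cl1) $x\cdot 1_\pi+x\cdot\overline{1}_\pi=x\cdot U$; (cl2) $1_\pi\sqcap(x+\overline{1}_\pi)=x\cdot 0$; (cl3) $x\cdot(y\|z)\le(x\cdot y)\|(x\cdot z)$; (cl4) $z\|z\le z\Rightarrow (x\|y)\cdot z=(x\cdot z)\|(y\cdot z)$; (cl5) $x\cdot(y\cdot(z\cdot 0))=(x\cdot y)\cdot(z\cdot 0)$; (cl6) $(x\cdot 0)\cdot y=x\cdot(0\cdot y)$; (cl7) $1_\sigma\|1_\sigma=1_\sigma$; (cl8) $((x\cdot 1_\pi)\|1_\sigma)\cdot y=(x\cdot 1_\pi)\|y$; (cl9) $((x\sqcap 1_\sigma)\cdot 1_\pi)\|1_\sigma=x\sqcap 1_\sigma$; (cl10) $((x\sqcap\overline{1}_\pi)\cdot 1_\pi)\|1_\sigma=1_\sigma\sqcap((x\sqcap\overline{1}_\pi)\cdot\overline{1}_\pi)$; (cl11) $((x\sqcap\overline{1}_\pi)\cdot 1_\pi)\|\overline{1}_\pi=(x\sqcap\overline{1}_\pi)\cdot\overline{1}_\pi$. It is boolean if its lattice reduct is a Boolean algebra. *)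

theory Defs
  imports "HOL-Algebra.Complete_Lattice"
begin

section \<open>Boolean c-quantales\<close>

text \<open>A family in the carrier enters a supremum only through its set of values, so the
  distributivity laws below are stated for subsets of the carrier; these include the empty set.\<close>

locale proto_quantale = complete_lattice L for L (structure) +
  fixes mult :: "'a \<Rightarrow> 'a \<Rightarrow> 'a" (infixl \<open>\<odot>\<close> 70)
  assumes mult_closed: "\<lbrakk>x \<in> carrier L; y \<in> carrier L\<rbrakk> \<Longrightarrow> x \<odot> y \<in> carrier L"
    and mult_mono_right:
      "\<lbrakk>x \<in> carrier L; y \<in> carrier L; z \<in> carrier L; x \<sqsubseteq> y\<rbrakk> \<Longrightarrow> z \<odot> x \<sqsubseteq> z \<odot> y"
    and Sup_mult_distrib:
      "\<lbrakk>A \<subseteq> carrier L; y \<in> carrier L\<rbrakk> \<Longrightarrow> (\<Squnion>A) \<odot> y = \<Squnion>((\<lambda>x. x \<odot> y) ` A)"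

locale unital_proto_quantale = proto_quantale L mult
  for L (structure) and mult (infixl \<open>\<odot>\<close> 70) +
  fixes unit :: 'a (\<open>\<^bold>1\<close>)
  assumes unit_closed: "\<^bold>1 \<in> carrier L"
    and unit_left: "x \<in> carrier L \<Longrightarrow> \<^bold>1 \<odot> x = x"
    and unit_right: "x \<in> carrier L \<Longrightarrow> x \<odot> \<^bold>1 = x"

locale quantale = proto_quantale L mult
  for L (structure) and mult (infixl \<open>\<odot>\<close> 70) +
  assumes mult_assoc:
      "\<lbrakk>x \<in> carrier L; y \<in> carrier L; z \<in> carrier L\<rbrakk> \<Longrightarrow> (x \<odot> y) \<odot> z = x \<odot> (y \<odot> z)"
    and mult_Sup_distrib:
      "\<lbrakk>A \<subseteq> carrier L; x \<in> carrier L\<rbrakk> \<Longrightarrow> x \<odot> (\<Squnion>A) = \<Squnion>((\<lambda>y. x \<odot> y) ` A)"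

locale unital_commutative_quantale = quantale L mult + unital_proto_quantale L mult unit
  for L (structure) and mult (infixl \<open>\<odot>\<close> 70) and unit (\<open>\<^bold>1\<close>) +
  assumes mult_comm: "\<lbrakk>x \<in> carrier L; y \<in> carrier L\<rbrakk> \<Longrightarrow> x \<odot> y = y \<odot> x"

locale proto_bi_quantale =
  seq: unital_proto_quantale L seq sid + par: unital_commutative_quantale L par pid
  for L (structure)
    and seq (infixl \<open>\<cdot>\<close> 80) and par (infixl \<open>\<parallel>\<close> 75)
    and sid (\<open>1\<^sub>\<sigma>\<close>) and pid (\<open>1\<^sub>\<pi>\<close>)

text \<open>The lattice operations and bounds are explicit parameters, tied to those of the order by
  the first assumptions. The parameter \<open>nonpid\<close> is the distinguished element \<open>1\<^sub>\<pi>\<close> with a bar;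
  the laws of a c-quantale do not require it to be a complement of \<open>1\<^sub>\<pi>\<close>.\<close>

locale c_quantale = proto_bi_quantale L seq par sid pid
  for L (structure)
    and seq (infixl \<open>\<cdot>\<close> 80) and par (infixl \<open>\<parallel>\<close> 75)
    and sid (\<open>1\<^sub>\<sigma>\<close>) and pid (\<open>1\<^sub>\<pi>\<close>) +
  fixes add :: "'a \<Rightarrow> 'a \<Rightarrow> 'a" (infixl \<open>\<^bold>+\<close> 65)
    and cap :: "'a \<Rightarrow> 'a \<Rightarrow> 'a" (infixl \<open>\<^bold>\<and>\<close> 70)
    and zero :: 'a (\<open>\<^bold>0\<close>)
    and U :: 'a
    and nonpid :: 'a
  assumes add_eq_join: "\<lbrakk>x \<in> carrier L; y \<in> carrier L\<rbrakk> \<Longrightarrow> x \<^bold>+ y = x \<squnion> y"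
    and cap_eq_meet: "\<lbrakk>x \<in> carrier L; y \<in> carrier L\<rbrakk> \<Longrightarrow> x \<^bold>\<and> y = x \<sqinter> y"
    and zero_eq_bottom: "\<^bold>0 = \<bottom>"
    and U_eq_top: "U = \<top>"
    and nonpid_closed: "nonpid \<in> carrier L"
    and cap_add_distrib:
      "\<lbrakk>x \<in> carrier L; y \<in> carrier L; z \<in> carrier L\<rbrakk>
        \<Longrightarrow> x \<^bold>\<and> (y \<^bold>+ z) = (x \<^bold>\<and> y) \<^bold>+ (x \<^bold>\<and> z)"
    and cl1: "x \<in> carrier L \<Longrightarrow> (x \<cdot> 1\<^sub>\<pi>) \<^bold>+ (x \<cdot> nonpid) = x \<cdot> U"
    and cl2: "x \<in> carrier L \<Longrightarrow> 1\<^sub>\<pi> \<^bold>\<and> (x \<^bold>+ nonpid) = x \<cdot> \<^bold>0"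
    and cl3: "\<lbrakk>x \<in> carrier L; y \<in> carrier L; z \<in> carrier L\<rbrakk>
        \<Longrightarrow> x \<cdot> (y \<parallel> z) \<sqsubseteq> (x \<cdot> y) \<parallel> (x \<cdot> z)"
    and cl4: "\<lbrakk>x \<in> carrier L; y \<in> carrier L; z \<in> carrier L; z \<parallel> z \<sqsubseteq> z\<rbrakk>
        \<Longrightarrow> (x \<parallel> y) \<cdot> z = (x \<cdot> z) \<parallel> (y \<cdot> z)"
    and cl5: "\<lbrakk>x \<in> carrier L; y \<in> carrier L; z \<in> carrier L\<rbrakk>
        \<Longrightarrow> x \<cdot> (y \<cdot> (z \<cdot> \<^bold>0)) = (x \<cdot> y) \<cdot> (z \<cdot> \<^bold>0)"
    and cl6: "\<lbrakk>x \<in> carrier L; y \<in> carrier L\<rbrakk> \<Longrightarrow> (x \<cdot> \<^bold>0) \<cdot> y = x \<cdot> (\<^bold>0 \<cdot> y)"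
    and cl7: "1\<^sub>\<sigma> \<parallel> 1\<^sub>\<sigma> = 1\<^sub>\<sigma>"
    and cl8: "\<lbrakk>x \<in> carrier L; y \<in> carrier L\<rbrakk>
        \<Longrightarrow> ((x \<cdot> 1\<^sub>\<pi>) \<parallel> 1\<^sub>\<sigma>) \<cdot> y = (x \<cdot> 1\<^sub>\<pi>) \<parallel> y"
    and cl9: "x \<in> carrier L \<Longrightarrow> ((x \<^bold>\<and> 1\<^sub>\<sigma>) \<cdot> 1\<^sub>\<pi>) \<parallel> 1\<^sub>\<sigma> = x \<^bold>\<and> 1\<^sub>\<sigma>"
    and cl10: "x \<in> carrier L
        \<Longrightarrow> ((x \<^bold>\<and> nonpid) \<cdot> 1\<^sub>\<pi>) \<parallel> 1\<^sub>\<sigma> = 1\<^sub>\<sigma> \<^bold>\<and> ((x \<^bold>\<and> nonpid) \<cdot> nonpid)"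
    and cl11: "x \<in> carrier L
        \<Longrightarrow> ((x \<^bold>\<and> nonpid) \<cdot> 1\<^sub>\<pi>) \<parallel> nonpid = (x \<^bold>\<and> nonpid) \<cdot> nonpid"

text \<open>The lattice reduct is already bounded and distributive, so it is a Boolean algebra as soon
  as every element has a complement.\<close>

locale boolean_c_quantale = c_quantale +
  assumes complemented:
    "x \<in> carrier L \<Longrightarrow> \<exists>y \<in> carrier L. x \<^bold>\<and> y = \<^bold>0 \<and> x \<^bold>+ y = U"

section \<open>Multirelations\<close>

type_synonym 'a mrel = "('a \<times> 'a set) set"

definition multirelations :: "'a set \<Rightarrow> 'a mrel set" where
  "multirelations X = Pow (X \<times> Pow X)"

definition mrel_order :: "'a set \<Rightarrow> 'a mrel gorder" where
  "mrel_order X = \<lparr>carrier = multirelations X, eq = (=), le = (\<subseteq>)\<rparr>"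

definition mrel_seq :: "'a mrel \<Rightarrow> 'a mrel \<Rightarrow> 'a mrel" where
  "mrel_seq R S =
    {(a, A). \<exists>B. (a, B) \<in> R \<and> (\<exists>f. (\<forall>b\<in>B. (b, f b) \<in> S) \<and> A = (\<Union>b\<in>B. f b))}"

definition mrel_par :: "'a mrel \<Rightarrow> 'a mrel \<Rightarrow> 'a mrel" where
  "mrel_par R S = {(a, A \<union> B) | a A B. (a, A) \<in> R \<and> (a, B) \<in> S}"

definition mrel_sid :: "'a set \<Rightarrow> 'a mrel" where
  "mrel_sid X = {(x, {x}) | x. x \<in> X}"

definition mrel_pid :: "'a set \<Rightarrow> 'a mrel" where
  "mrel_pid X = {(x, {}) | x. x \<in> X}"

definition mrel_U :: "'a set \<Rightarrow> 'a mrel" where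
  "mrel_U X = X \<times> Pow X"

definition mrel_nonpid :: "'a set \<Rightarrow> 'a mrel" where
  "mrel_nonpid X = mrel_U X - mrel_pid X"

end

theory Submission
  imports Defs
begin

text \<open>The carrier is the power set of X x Pow X, so the order part is a complete Boolean
  algebra of sets. Both compositions are defined by existential conditions on pairs, hence preserve
  unions on the left. Parallel composition is commutative, so it also preserves them on the right;
  sequential composition is only monotone there, because one choice function may draw its values
  from different members of a family.

  The remaining laws rest on two observations. First, whether (a, A) lies in R composed with
  \<open>mrel_pid X\<close>, \<open>{}\<close>, \<open>mrel_nonpid X\<close> or
  \<open>mrel_U X\<close> depends only on A and on whether R relates a to the empty set or to some
  nonempty set (\<open>mem_mrel_seq_pid\<close> and its companions). This decides the laws about the
  constants pointwise. Second, choice functions can be split (\<open>mrel_cl3\<close>), merged when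
  the target is closed under parallel composition (\<open>mrel_cl4\<close>), and combined without
  conflict when all their values are empty (\<open>mrel_seq_assoc_subpid\<close>).\<close>

lemma mem_mrel_seq:
  "(a, A) \<in> mrel_seq R S \<longleftrightarrow>
    (\<exists>B f. (a, B) \<in> R \<and> (\<forall>b\<in>B. (b, f b) \<in> S) \<and> A = (\<Union>b\<in>B. f b))"
  by (auto simp: mrel_seq_def)

lemma mem_mrel_seqI:
  "\<lbrakk>(a, B) \<in> R; \<And>b. b \<in> B \<Longrightarrow> (b, f b) \<in> S; A = (\<Union>b\<in>B. f b)\<rbrakk> \<Longrightarrow> (a, A) \<in> mrel_seq R S"
  by (auto simp: mem_mrel_seq)

lemma mem_mrel_seqE:
  assumes "(a, A) \<in> mrel_seq R S"
  obtains B f where "(a, B) \<in> R" "\<And>b. b \<in> B \<Longrightarrow> (b, f b) \<in> S" "A = (\<Union>b\<in>B. f b)"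
  using assms by (auto simp: mem_mrel_seq)

lemma mem_mrel_par:
  "(a, C) \<in> mrel_par R S \<longleftrightarrow> (\<exists>A B. (a, A) \<in> R \<and> (a, B) \<in> S \<and> C = A \<union> B)"
  by (auto simp: mrel_par_def)

lemma mem_mrel_sid: "(a, A) \<in> mrel_sid X \<longleftrightarrow> a \<in> X \<and> A = {a}"
  by (auto simp: mrel_sid_def)

lemma mem_mrel_pid: "(a, A) \<in> mrel_pid X \<longleftrightarrow> a \<in> X \<and> A = {}"
  by (auto simp: mrel_pid_def)

lemma mem_mrel_U: "(a, A) \<in> mrel_U X \<longleftrightarrow> a \<in> X \<and> A \<subseteq> X"
  by (auto simp: mrel_U_def)

lemma mem_mrel_nonpid: "(a, A) \<in> mrel_nonpid X \<longleftrightarrow> a \<in> X \<and> A \<subseteq> X \<and> A \<noteq> {}"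
  by (auto simp: mrel_nonpid_def mem_mrel_U mem_mrel_pid)

lemmas mrel_mem = mem_mrel_par mem_mrel_sid mem_mrel_pid mem_mrel_U mem_mrel_nonpid

lemma multirelationsD:
  "\<lbrakk>R \<in> multirelations X; (a, A) \<in> R\<rbrakk> \<Longrightarrow> a \<in> X \<and> A \<subseteq> X"
  by (auto simp: multirelations_def)

lemma multirelationsI:
  "(\<And>a A. (a, A) \<in> R \<Longrightarrow> a \<in> X \<and> A \<subseteq> X) \<Longrightarrow> R \<in> multirelations X"
  by (auto simp: multirelations_def)

lemma mrel_consts_closed:
  "{} \<in> multirelations X" "mrel_sid X \<in> multirelations X" "mrel_pid X \<in> multirelations X"
  "mrel_U X \<in> multirelations X" "mrel_nonpid X \<in> multirelations X"
  by (auto intro!: multirelationsI simp: mrel_mem)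

lemma Union_closed: "M \<subseteq> multirelations X \<Longrightarrow> \<Union>M \<in> multirelations X"
  by (auto simp: multirelations_def)

lemma mrel_seq_closed:
  assumes "R \<in> multirelations X" "S \<in> multirelations X"
  shows "mrel_seq R S \<in> multirelations X"
proof (rule multirelationsI)
  fix a A assume "(a, A) \<in> mrel_seq R S"
  then show "a \<in> X \<and> A \<subseteq> X"
    by (elim mem_mrel_seqE) (use assms in \<open>blast dest: multirelationsD\<close>)
qed

lemma mrel_par_closed:
  assumes "R \<in> multirelations X" "S \<in> multirelations X"
  shows "mrel_par R S \<in> multirelations X"
  by (rule multirelationsI) (auto simp: mem_mrel_par dest: multirelationsD[OF assms(1)] multirelationsD[OF assms(2)])

section \<open>The complete lattice of multirelations\<close>

lemma mrel_order_simps [simp]: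
  "carrier (mrel_order X) = multirelations X" "le (mrel_order X) = (\<subseteq>)" "eq (mrel_order X) = (=)"
  by (simp_all add: mrel_order_def)

lemma partial_order_mrel: "partial_order (mrel_order X)"
  by unfold_locales auto

lemma least_Union:
  assumes "M \<subseteq> multirelations X"
  shows "least (mrel_order X) (\<Union>M) (Upper (mrel_order X) M)"
  using assms Union_closed[OF assms] by (auto simp: least_def Upper_def)

text \<open>Cutting with \<open>mrel_U X\<close> matters for the empty family, whose intersection
  would otherwise be \<open>UNIV\<close> instead of the top element.\<close>

lemma greatest_Inter:
  assumes "M \<subseteq> multirelations X"
  shows "greatest (mrel_order X) (mrel_U X \<inter> \<Inter>M) (Lower (mrel_order X) M)"
  using assms by (fastforce simp: greatest_def Lower_def multirelations_def mrel_U_def)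

lemma complete_lattice_mrel: "complete_lattice (mrel_order X)"
proof -
  interpret partial_order "mrel_order X" by (rule partial_order_mrel)
  show ?thesis
    by unfold_locales (simp_all, (rule exI, erule least_Union greatest_Inter)+)
qed

lemma sup_mrel:
  assumes "M \<subseteq> multirelations X"
  shows "\<Squnion>\<^bsub>mrel_order X\<^esub> M = \<Union>M"
proof -
  interpret partial_order "mrel_order X" by (rule partial_order_mrel)
  show ?thesis
    unfolding sup_def
    by (rule some_equality) (use least_Union[OF assms] least_unique in auto)
qed

lemma inf_mrel:
  assumes "M \<subseteq> multirelations X"
  shows "\<Sqinter>\<^bsub>mrel_order X\<^esub> M = mrel_U X \<inter> \<Inter>M"
proof -
  interpret partial_order "mrel_order X" by (rule partial_order_mrel)
  show ?thesis
    unfolding inf_def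
    by (rule some_equality) (use greatest_Inter[OF assms] greatest_unique in auto)
qed

lemma mrel_lattice_ops:
  assumes "R \<in> multirelations X" "S \<in> multirelations X"
  shows "R \<squnion>\<^bsub>mrel_order X\<^esub> S = R \<union> S" "R \<sqinter>\<^bsub>mrel_order X\<^esub> S = R \<inter> S"
  using assms by (auto simp: join_def meet_def sup_mrel inf_mrel multirelations_def mrel_U_def)

lemma bottom_mrel: "\<bottom>\<^bsub>mrel_order X\<^esub> = {}"
proof -
  interpret complete_lattice "mrel_order X" by (rule complete_lattice_mrel)
  show ?thesis
    using bottom_lower[of "{}"] mrel_consts_closed(1)[of X] by simp
qed

lemma top_mrel: "\<top>\<^bsub>mrel_order X\<^esub> = mrel_U X"
proof -
  interpret complete_lattice "mrel_order X" by (rule complete_lattice_mrel)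
  show ?thesis
    using top_higher[of "mrel_U X"] top_closed mrel_consts_closed(4)[of X]
    by (auto simp: multirelations_def mrel_U_def)
qed

section \<open>Quantale laws of the two compositions\<close>

lemma mrel_seq_mono: "S \<subseteq> T \<Longrightarrow> mrel_seq R S \<subseteq> mrel_seq R T"
  by (auto simp: mem_mrel_seq) blast

lemma mrel_seq_Union_left: "mrel_seq (\<Union>M) S = (\<Union>R\<in>M. mrel_seq R S)"
  by (auto simp: mem_mrel_seq) blast+

lemma mrel_seq_sid_left:
  assumes "R \<in> multirelations X"
  shows "mrel_seq (mrel_sid X) R = R"
proof (intro subset_antisym; clarify)
  fix a A assume "(a, A) \<in> mrel_seq (mrel_sid X) R"
  then show "(a, A) \<in> R" by (elim mem_mrel_seqE) (auto simp: mem_mrel_sid)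
next
  fix a A assume *: "(a, A) \<in> R"
  show "(a, A) \<in> mrel_seq (mrel_sid X) R"
    by (rule mem_mrel_seqI[of a "{a}" _ "\<lambda>_. A"])
      (use * multirelationsD[OF assms *] in \<open>auto simp: mem_mrel_sid\<close>)
qed

lemma mrel_seq_sid_right:
  assumes "R \<in> multirelations X"
  shows "mrel_seq R (mrel_sid X) = R"
proof (intro subset_antisym; clarify)
  fix a A assume "(a, A) \<in> mrel_seq R (mrel_sid X)"
  then show "(a, A) \<in> R" by (elim mem_mrel_seqE) (simp add: mem_mrel_sid)
next
  fix a A assume *: "(a, A) \<in> R"
  show "(a, A) \<in> mrel_seq R (mrel_sid X)"
    by (rule mem_mrel_seqI[OF *, where f = "\<lambda>b. {b}"])
      (use multirelationsD[OF assms *] in \<open>auto simp: mem_mrel_sid\<close>)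
qed

lemma mrel_par_assoc: "mrel_par (mrel_par R S) T = mrel_par R (mrel_par S T)"
  by (auto simp: mem_mrel_par) (metis Un_assoc)+

lemma mrel_par_comm: "mrel_par R S = mrel_par S R"
  by (auto simp: mem_mrel_par) (metis Un_commute)+

text \<open>Completes associativity and commutativity to a set of rules for ordered
  rewriting.\<close>

lemma mrel_par_left_comm: "mrel_par R (mrel_par S T) = mrel_par S (mrel_par R T)"
  using mrel_par_assoc mrel_par_comm by metis

lemma mrel_par_Union_left: "mrel_par (\<Union>M) S = (\<Union>R\<in>M. mrel_par R S)"
  unfolding mrel_par_def by blast

lemma mrel_par_Union_right: "mrel_par R (\<Union>M) = (\<Union>S\<in>M. mrel_par R S)"
  unfolding mrel_par_def by blast

lemma mrel_par_mono: "\<lbrakk>R \<subseteq> R'; S \<subseteq> S'\<rbrakk> \<Longrightarrow> mrel_par R S \<subseteq> mrel_par R' S'"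
  unfolding mrel_par_def by blast

lemma mrel_par_pid_right: "R \<in> multirelations X \<Longrightarrow> mrel_par R (mrel_pid X) = R"
  by (auto simp: mem_mrel_par mem_mrel_pid dest: multirelationsD)

section \<open>Sequential composition with constants\<close>

text \<open>Below \<open>mrel_pid X\<close> the only value a choice function can take is
  \<open>{}\<close>, so the choice disappears and a mere test on the elements of \<open>B\<close>
  remains.\<close>

lemma mem_mrel_seq_subpid:
  assumes "T \<subseteq> mrel_pid X"
  shows "(a, A) \<in> mrel_seq R T \<longleftrightarrow> A = {} \<and> (\<exists>B. (a, B) \<in> R \<and> (\<forall>b\<in>B. (b, {}) \<in> T))"
proof -
  have *: "A = {}" if "(b, A) \<in> T" for b A
    using that assms by (auto simp: mrel_pid_def)
  show ?thesis
    by (auto simp: mem_mrel_seq dest: *) (metis *, fastforce)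
qed

text \<open>Each \<open>B\<close> lies inside \<open>X\<close>, where the test always succeeds; the
  composite therefore encodes the domain of \<open>R\<close>.\<close>

lemma mem_mrel_seq_pid:
  assumes "R \<in> multirelations X"
  shows "(a, A) \<in> mrel_seq R (mrel_pid X) \<longleftrightarrow> A = {} \<and> (\<exists>B. (a, B) \<in> R)"
  using multirelationsD[OF assms] by (auto simp: mem_mrel_seq_subpid[OF order_refl] mem_mrel_pid)

lemma mem_mrel_seq_empty: "(a, A) \<in> mrel_seq R {} \<longleftrightarrow> A = {} \<and> (a, {}) \<in> R"
  by (auto simp: mem_mrel_seq)

text \<open>A nonempty union of images is also attained by the constant choice function, whose values
  are then nonempty.\<close>

lemma mem_mrel_seq_nonpid:
  assumes "R \<in> multirelations X"
  shows "(a, A) \<in> mrel_seq R (mrel_nonpid X) \<longleftrightarrow>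
    (if A = {} then (a, {}) \<in> R else A \<subseteq> X \<and> (\<exists>B. B \<noteq> {} \<and> (a, B) \<in> R))"
proof -
  have "(a, A) \<in> mrel_seq R (mrel_nonpid X)" if "(a, B) \<in> R" "B \<noteq> {}" "A \<subseteq> X" "A \<noteq> {}" for B
    by (rule mem_mrel_seqI[OF that(1), where f = "\<lambda>_. A"])
      (use that multirelationsD[OF assms that(1)] in \<open>auto simp: mem_mrel_nonpid\<close>)
  then show ?thesis
    by (auto simp: mem_mrel_seq[where S = "mrel_nonpid X"] mem_mrel_nonpid)
qed

lemma mem_mrel_seq_U:
  assumes "R \<in> multirelations X"
  shows "(a, A) \<in> mrel_seq R (mrel_U X) \<longleftrightarrow>
    (if A = {} then \<exists>B. (a, B) \<in> R else A \<subseteq> X \<and> (\<exists>B. B \<noteq> {} \<and> (a, B) \<in> R))"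
proof -
  have "(a, A) \<in> mrel_seq R (mrel_U X)" if "(a, B) \<in> R" "B = {} \<longleftrightarrow> A = {}" "A \<subseteq> X" for B
    by (rule mem_mrel_seqI[OF that(1), where f = "\<lambda>_. A"])
      (use that multirelationsD[OF assms that(1)] in \<open>auto simp: mem_mrel_U\<close>)
  \<comment> \<open>In contrast to \<open>mrel_nonpid X\<close>, a nonempty \<open>B\<close> can
    also yield the empty union here, by choosing \<open>{}\<close> throughout.\<close>
  moreover have "(a, {}) \<in> mrel_seq R (mrel_U X)" if "(a, B) \<in> R" for B
    by (rule mem_mrel_seqI[OF that, where f = "\<lambda>_. {}"])
      (use multirelationsD[OF assms that] in \<open>auto simp: mem_mrel_U\<close>)
  ultimately show ?thesis
    by (auto simp: mem_mrel_seq[where S = "mrel_U X"] mem_mrel_U)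
qed

section \<open>Interaction of the two compositions\<close>

text \<open>A choice function into a parallel composite splits pointwise into two over the same
  \<open>B\<close>. Only an inclusion results, since the two factors on the right may start from
  different sets.\<close>

lemma mrel_cl3: "mrel_seq R (mrel_par S T) \<subseteq> mrel_par (mrel_seq R S) (mrel_seq R T)"
proof clarify
  fix a A assume "(a, A) \<in> mrel_seq R (mrel_par S T)"
  then obtain B h where B: "(a, B) \<in> R" "\<And>b. b \<in> B \<Longrightarrow> (b, h b) \<in> mrel_par S T"
    and A: "A = (\<Union>b\<in>B. h b)" by (rule mem_mrel_seqE) blast
  from B(2) obtain f g where "\<And>b. b \<in> B \<Longrightarrow> (b, f b) \<in> S \<and> (b, g b) \<in> T \<and> h b = f b \<union> g b"
    unfolding mem_mrel_par by metis
  with B(1) A have "(a, \<Union>b\<in>B. f b) \<in> mrel_seq R S" "(a, \<Union>b\<in>B. g b) \<in> mrel_seq R T"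
    "A = (\<Union>b\<in>B. f b) \<union> (\<Union>b\<in>B. g b)"
    by (auto intro: mem_mrel_seqI)
  then show "(a, A) \<in> mrel_par (mrel_seq R S) (mrel_seq R T)"
    unfolding mem_mrel_par by blast
qed

text \<open>The hypothesis on \<open>T\<close> is what allows two choice functions to be merged where their
  domains overlap.\<close>

lemma mrel_cl4:
  assumes "mrel_par T T \<subseteq> T"
  shows "mrel_seq (mrel_par R S) T = mrel_par (mrel_seq R T) (mrel_seq S T)"
proof (intro subset_antisym; clarify)
  fix a A assume "(a, A) \<in> mrel_seq (mrel_par R S) T"
  then obtain B C f where "(a, B) \<in> R" "(a, C) \<in> S" "\<And>b. b \<in> B \<union> C \<Longrightarrow> (b, f b) \<in> T"
    and A: "A = (\<Union>b\<in>B \<union> C. f b)"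
    by (elim mem_mrel_seqE) (fastforce simp: mem_mrel_par)
  then have "(a, \<Union>b\<in>B. f b) \<in> mrel_seq R T" "(a, \<Union>b\<in>C. f b) \<in> mrel_seq S T"
    by (auto intro: mem_mrel_seqI)
  then show "(a, A) \<in> mrel_par (mrel_seq R T) (mrel_seq S T)"
    unfolding mem_mrel_par A UN_Un by blast
next
  fix a A assume "(a, A) \<in> mrel_par (mrel_seq R T) (mrel_seq S T)"
  then obtain B C f g where B: "(a, B) \<in> R" "\<And>b. b \<in> B \<Longrightarrow> (b, f b) \<in> T"
    and C: "(a, C) \<in> S" "\<And>b. b \<in> C \<Longrightarrow> (b, g b) \<in> T"
    and A: "A = (\<Union>b\<in>B. f b) \<union> (\<Union>b\<in>C. g b)"
    unfolding mem_mrel_par mem_mrel_seq by blast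
  \<comment> \<open>The default \<open>{}\<close> makes \<open>h\<close> agree with \<open>f\<close>
    or \<open>g\<close> where only one of them applies, and adds nothing to the total union.\<close>
  define h where "h b = (if b \<in> B then f b else {}) \<union> (if b \<in> C then g b else {})" for b
  have "(b, f b \<union> g b) \<in> T" if "b \<in> B" "b \<in> C" for b
    using assms B(2)[OF that(1)] C(2)[OF that(2)] by (auto simp: mrel_par_def)
  then have "(b, h b) \<in> T" if "b \<in> B \<union> C" for b
    using that B(2) C(2) by (auto simp: h_def)
  moreover have "(a, B \<union> C) \<in> mrel_par R S"
    using B(1) C(1) by (auto simp: mem_mrel_par)
  moreover have "A = (\<Union>b\<in>B \<union> C. h b)"
    unfolding A h_def by (auto split: if_splits)
  ultimately show "(a, A) \<in> mrel_seq (mrel_par R S) T"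
    by (auto intro: mem_mrel_seqI)
qed

text \<open>Passing from left to right in general, the choices into \<open>T\<close> made for
  different elements of \<open>B\<close> may conflict on a common successor. With \<open>T\<close>
  below \<open>mrel_pid X\<close> every such choice is \<open>{}\<close>, so they agree.\<close>

lemma mrel_seq_assoc_subpid:
  assumes "T \<subseteq> mrel_pid X"
  shows "mrel_seq R (mrel_seq S T) = mrel_seq (mrel_seq R S) T"
proof -
  \<comment> \<open>\<open>S\<close> may relate points outside \<open>X\<close> to the empty set,
    hence the bound over \<open>UNIV\<close>.\<close>
  have ST: "mrel_seq S T \<subseteq> mrel_pid UNIV"
    by (auto simp: mem_mrel_seq_subpid[OF assms] mem_mrel_pid)
  have "(\<exists>B. (a, B) \<in> R \<and> (\<forall>b\<in>B. \<exists>C. (b, C) \<in> S \<and> (\<forall>c\<in>C. (c, {}) \<in> T))) \<longleftrightarrow>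
    (\<exists>A. (a, A) \<in> mrel_seq R S \<and> (\<forall>c\<in>A. (c, {}) \<in> T))" (is "?L \<longleftrightarrow> ?R") for a
  proof
    assume ?L
    then obtain B f where "(a, B) \<in> R"
      "\<And>b. b \<in> B \<Longrightarrow> (b, f b) \<in> S \<and> (\<forall>c\<in>f b. (c, {}) \<in> T)" by metis
    then show ?R by (intro exI[of _ "\<Union>b\<in>B. f b"]) (auto intro: mem_mrel_seqI)
  next
    assume ?R
    then show ?L by (fastforce simp: mem_mrel_seq)
  qed
  then show ?thesis
    by (auto simp: mem_mrel_seq_subpid[OF assms] mem_mrel_seq_subpid[OF ST])
qed

text \<open>The parallel composite with \<open>mrel_sid X\<close> is the identity on the domain of
  \<open>R\<close>. Both sides thus restrict \<open>S\<close> to that domain.\<close>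

lemma mrel_cl8:
  assumes "R \<in> multirelations X" "S \<in> multirelations X"
  shows "mrel_seq (mrel_par (mrel_seq R (mrel_pid X)) (mrel_sid X)) S
    = mrel_par (mrel_seq R (mrel_pid X)) S"
proof -
  have "(a, B) \<in> mrel_par (mrel_seq R (mrel_pid X)) (mrel_sid X) \<longleftrightarrow>
    B = {a} \<and> (\<exists>C. (a, C) \<in> R)" for a B
    using multirelationsD[OF assms(1)]
    by (auto simp: mem_mrel_par mem_mrel_sid mem_mrel_seq_pid[OF assms(1)])
  then show ?thesis
    by (fastforce simp: mem_mrel_seq[where S = S] mem_mrel_par mem_mrel_seq_pid[OF assms(1)])
qed

lemma Int_closed: "R \<in> multirelations X \<Longrightarrow> R \<inter> S \<in> multirelations X"
  by (auto simp: multirelations_def)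

section \<open>Verification of the axioms\<close>

lemma proto_bi_quantale_mrel:
  "proto_bi_quantale (mrel_order X) mrel_seq mrel_par (mrel_sid X) (mrel_pid X)"
proof -
  interpret complete_lattice "mrel_order X" by (rule complete_lattice_mrel)
  \<comment> \<open>Needed to rewrite the suprema of image families to unions by
    \<open>sup_mrel\<close>.\<close>
  have image_closed: "(\<lambda>R. mrel_seq R S) ` M \<subseteq> multirelations X"
    "(\<lambda>R. mrel_par R S) ` M \<subseteq> multirelations X" "mrel_par S ` M \<subseteq> multirelations X"
    if "M \<subseteq> multirelations X" "S \<in> multirelations X" for M S
    using that by (auto intro: mrel_seq_closed mrel_par_closed)
  show ?thesis
    by unfold_locales
      (simp_all add: mrel_seq_closed mrel_par_closed mrel_consts_closed sup_mrel image_closed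
        mrel_seq_mono mrel_par_mono mrel_seq_Union_left mrel_seq_sid_left mrel_seq_sid_right
        mrel_par_Union_left mrel_par_Union_right mrel_par_pid_right mrel_par_assoc mrel_par_comm
        mrel_par_left_comm)
qed

theorem theorem55:
  fixes X :: "'a set"
  shows "boolean_c_quantale (mrel_order X) mrel_seq mrel_par (mrel_sid X) (mrel_pid X)
           (\<union>) (\<inter>) {} (mrel_U X) (mrel_nonpid X)"
proof -
  interpret proto_bi_quantale "mrel_order X" mrel_seq mrel_par "mrel_sid X" "mrel_pid X"
    by (rule proto_bi_quantale_mrel)
  show ?thesis
  proof (unfold_locales, unfold mrel_order_simps)
    fix R S :: "'a mrel" assume R: "R \<in> multirelations X" and S: "S \<in> multirelations X"
    show "R \<union> S = R \<squnion>\<^bsub>mrel_order X\<^esub> S" "R \<inter> S = R \<sqinter>\<^bsub>mrel_order X\<^esub> S"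
      using R S by (simp_all add: mrel_lattice_ops)
    \<comment> \<open>Both sides equal \<open>mrel_seq R {}\<close>: its pairs have empty second
      component, so composing with \<open>S\<close> leaves them unchanged.\<close>
    show "mrel_seq (mrel_seq R {}) S = mrel_seq R (mrel_seq {} S)"
    proof -
      have "mrel_seq {} S = {}"
        by (auto simp: mem_mrel_seq)
      then show ?thesis
        by (auto simp: mem_mrel_seq_empty mem_mrel_seq[where S = S])
    qed
    show "mrel_seq (mrel_par (mrel_seq R (mrel_pid X)) (mrel_sid X)) S
      = mrel_par (mrel_seq R (mrel_pid X)) S"
      by (rule mrel_cl8[OF R S])
  next
    fix R S T :: "'a mrel" assume R: "R \<in> multirelations X" and S: "S \<in> multirelations X"
      and T: "T \<in> multirelations X"
    show "R \<inter> (S \<union> T) = R \<inter> S \<union> R \<inter> T" by blast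
    show "mrel_seq R (mrel_par S T) \<subseteq> mrel_par (mrel_seq R S) (mrel_seq R T)"
      by (rule mrel_cl3)
    show "mrel_seq R (mrel_seq S (mrel_seq T {})) = mrel_seq (mrel_seq R S) (mrel_seq T {})"
      by (rule mrel_seq_assoc_subpid[of _ X])
        (use multirelationsD[OF T] in \<open>auto simp: mem_mrel_seq_empty mem_mrel_pid\<close>)
    show "mrel_seq (mrel_par R S) T = mrel_par (mrel_seq R T) (mrel_seq S T)"
      if "mrel_par T T \<subseteq> T"
      using that by (rule mrel_cl4)
  next
    fix R :: "'a mrel" assume R: "R \<in> multirelations X"
    \<comment> \<open>The second operand stays schematic, so this serves the intersections with both
      \<open>mrel_sid X\<close> and \<open>mrel_nonpid X\<close>.\<close>
    note R' = Int_closed[OF R]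
    note mem = mrel_mem mem_mrel_seq_pid[OF R] mem_mrel_seq_pid[OF R'] mem_mrel_seq_empty
      mem_mrel_seq_nonpid[OF R] mem_mrel_seq_nonpid[OF R'] mem_mrel_seq_U[OF R]
    show "mrel_seq R (mrel_pid X) \<union> mrel_seq R (mrel_nonpid X) = mrel_seq R (mrel_U X)"
      by (auto simp: mem split: if_splits)
    show "mrel_pid X \<inter> (R \<union> mrel_nonpid X) = mrel_seq R {}"
      using multirelationsD[OF R] by (auto simp: mem)
    show "mrel_par (mrel_seq (R \<inter> mrel_sid X) (mrel_pid X)) (mrel_sid X) = R \<inter> mrel_sid X"
      by (auto simp: mem)
    \<comment> \<open>Both sides consist of the pairs (a, {a}) for which \<open>R\<close> relates a
      to a nonempty set; in the next law, {a} is replaced by an arbitrary nonempty subset of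
      \<open>X\<close>.\<close>
    show "mrel_par (mrel_seq (R \<inter> mrel_nonpid X) (mrel_pid X)) (mrel_sid X)
      = mrel_sid X \<inter> mrel_seq (R \<inter> mrel_nonpid X) (mrel_nonpid X)"
      by (auto simp: mem) blast
    show "mrel_par (mrel_seq (R \<inter> mrel_nonpid X) (mrel_pid X)) (mrel_nonpid X)
      = mrel_seq (R \<inter> mrel_nonpid X) (mrel_nonpid X)"
      by (auto simp: mem split: if_splits) blast
    show "\<exists>S\<in>multirelations X. R \<inter> S = {} \<and> R \<union> S = mrel_U X"
      by (rule bexI[of _ "mrel_U X - R"]) (use R in \<open>auto simp: multirelations_def mrel_U_def\<close>)
  next
    show "mrel_par (mrel_sid X) (mrel_sid X) = mrel_sid X"
      by (auto simp: mrel_mem)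
  qed (simp_all add: bottom_mrel top_mrel mrel_consts_closed)
qed

end
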